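(* Let $a<b$, let $\tau\in C^2(\mathbb R)$ and $\nu\in C^1(\mathbb R)$ be given real functions, and consider the Cauchy problem of finding a function $u(x,y)$ that satisfies $$(u_y^2-1)\,u_{xx}-2u_xu_y\,u_{xy}+u_x^2\,u_{yy}=0$$ together with the initial conditions $$u(x,0)=\tau(x),\qquad u_y(x,0)=\nu(x),\qquad a\le x\le b .$$ If $\tau'(x)\neq 0$ for all $x\in[a,b]$, then the integral of this Cauchy problem can be written in the form $$x=a+\frac12\int_a^{T(u+y)}(1-\nu(t))\,dt+\frac12\int_a^{T(u-y)}(1+\nu(t))\,dt ,$$ where $x=T(z)$ denotes the inverse function of $z=\tau(x)$ on $[a,b]$; that is, the solution $u=u(x,y)$ of the Cauchy problem is given implicitly by this relation.
   Context: The integral of the Cauchy problem means an implicit relation between $x$, $y$ and $u$ that is satisfied by the solution $u=u(x,y)$. Solutions are of class $C^2$. Since $\tau'\neq0$ on $[a,b]$, the function $\tau$ is injective on $[a,b]$ and its inverse $T:\tau([a,b])\to[a,b]$ is well defined, with $T(\tau(x))=x$ for $x\in[a,b]$. The relation is understood at points $(x,y)$ near the data segment $[a,b]\times\{0\}$ for which $u(x,y)+y$ and $u(x,y)-y$ belong to $\tau([a,b])$. *)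

theory Defs
  imports "HOL-Analysis.Analysis"
begin

definition C1_real :: "(real \<Rightarrow> real) \<Rightarrow> bool" where
  "C1_real f \<longleftrightarrow> f C1_differentiable_on UNIV"

definition C2_real :: "(real \<Rightarrow> real) \<Rightarrow> bool" where
  "C2_real f \<longleftrightarrow> C1_real f \<and> C1_real (deriv f)"

definition partial_x :: "(real \<times> real \<Rightarrow> real) \<Rightarrow> real \<times> real \<Rightarrow> real" where
  "partial_x u = (\<lambda>(x, y). deriv (\<lambda>s. u (s, y)) x)"

definition partial_y :: "(real \<times> real \<Rightarrow> real) \<Rightarrow> real \<times> real \<Rightarrow> real" where
  "partial_y u = (\<lambda>(x, y). deriv (\<lambda>t. u (x, t)) y)"

text \<open>The classes $C^1$ and $C^2$ are used on open sets only, where existence and continuity of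
  the partial derivatives already implies (total) differentiability and continuity of the function.
  Differentiability is required explicitly because \<^const>\<open>deriv\<close> is a total function.\<close>

definition C1_on :: "(real \<times> real) set \<Rightarrow> (real \<times> real \<Rightarrow> real) \<Rightarrow> bool" where
  "C1_on \<Omega> u \<longleftrightarrow>
     (\<forall>x y. (x, y) \<in> \<Omega> \<longrightarrow>
        (\<lambda>s. u (s, y)) differentiable (at x) \<and> (\<lambda>t. u (x, t)) differentiable (at y)) \<and>
     continuous_on \<Omega> (partial_x u) \<and> continuous_on \<Omega> (partial_y u)"

definition C2_on :: "(real \<times> real) set \<Rightarrow> (real \<times> real \<Rightarrow> real) \<Rightarrow> bool" where
  "C2_on \<Omega> u \<longleftrightarrow> C1_on \<Omega> u \<and> C1_on \<Omega> (partial_x u) \<and> C1_on \<Omega> (partial_y u)"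

definition pde_at :: "(real \<times> real \<Rightarrow> real) \<Rightarrow> real \<times> real \<Rightarrow> bool" where
  "pde_at u p \<longleftrightarrow>
     ((partial_y u p)\<^sup>2 - 1) * partial_x (partial_x u) p
     - 2 * partial_x u p * partial_y u p * partial_y (partial_x u) p
     + (partial_x u p)\<^sup>2 * partial_y (partial_y u) p = 0"

definition cauchy_solution ::
  "real \<Rightarrow> real \<Rightarrow> (real \<Rightarrow> real) \<Rightarrow> (real \<Rightarrow> real) \<Rightarrow> (real \<times> real) set \<Rightarrow> (real \<times> real \<Rightarrow> real) \<Rightarrow> bool"
where
  "cauchy_solution a b \<tau> \<nu> \<Omega> u \<longleftrightarrow>
     open \<Omega> \<and> {a..b} \<times> {0} \<subseteq> \<Omega> \<and> C2_on \<Omega> u \<and>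
     (\<forall>p\<in>\<Omega>. pde_at u p) \<and>
     (\<forall>x\<in>{a..b}. u (x, 0) = \<tau> x \<and> partial_y u (x, 0) = \<nu> x)"

definition integral_relation ::
  "real \<Rightarrow> (real \<Rightarrow> real) \<Rightarrow> (real \<Rightarrow> real) \<Rightarrow> real \<Rightarrow> real \<Rightarrow> real \<Rightarrow> bool"
where
  "integral_relation a \<nu> T x y z \<longleftrightarrow>
     x = a + 1/2 * integral {a..T (z + y)} (\<lambda>t. 1 - \<nu> t)
           + 1/2 * integral {a..T (z - y)} (\<lambda>t. 1 + \<nu> t)"

text \<open>For \<open>T\<close> with values in \<open>{a..b}\<close> the upper limits of integration are at least \<open>a\<close>, so
  integrals over the sets \<open>{a..T _}\<close> are the oriented integrals from \<open>a\<close>.\<close>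

end

theory Submission
  imports Defs
begin

text \<open>The proof interchanges the roles of \<open>x\<close> and \<open>u\<close>. Near the data segment \<open>u\<^sub>x\<close> is close to \<open>\<tau>' \<noteq> 0\<close>, so
the hodograph map \<open>(x, y) \<mapsto> (u(x, y), y)\<close> is injective on a convex neighbourhood of the segment, its
image is open, and \<open>x\<close> becomes a function \<open>\<xi>(v, y)\<close> of \<open>v = u\<close> and \<open>y\<close>, with \<open>\<xi>\<^sub>v = 1 / u\<^sub>x\<close> and
\<open>\<xi>\<^sub>y = - u\<^sub>y / u\<^sub>x\<close>. In these variables the quasilinear equation is the wave equation
\<open>\<xi>\<^sub>y\<^sub>y = \<xi>\<^sub>v\<^sub>v\<close>: its characteristics are the lines \<open>v + y = const\<close> and \<open>v - y = const\<close>, and the integral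
of the theorem is the formula of d'Alembert for \<open>\<xi>\<close>.

The wave equation is used in its factored form, so that only first derivatives of \<open>u\<^sub>x\<close> and \<open>u\<^sub>y\<close> have
to be transformed. The quantity
\<open>(1 - u\<^sub>y) / u\<^sub>x\<close>, which is \<open>\<xi>\<^sub>v + \<xi>\<^sub>y\<close>, is constant along the lines \<open>v + y = const\<close>
(\<open>slope_stationary\<close>; this is where the equation and the symmetry of second derivatives enter), so it
is known from the data. On a line \<open>v - y = \<tau> r\<close>, parametrised by the point \<open>q\<close> with
\<open>v + y = \<tau> q\<close>, it follows that \<open>\<xi>\<close> has the derivative \<open>(1 - \<nu> q) / 2\<close>, and integration from \<open>r\<close>, where
\<open>\<xi> = r\<close>, to \<open>s\<close> gives the formula (\<open>dAlembert\<close>).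

Both halves of the theorem follow at once. By compactness the image of the hodograph map contains the
points \<open>(z, y)\<close> with \<open>z + y\<close> and \<open>z - y\<close> in \<open>\<tau>([a, b])\<close> as soon as \<open>y\<close> is small enough, and for such points
the relation says precisely that \<open>x = \<xi>(z, y)\<close>, that is, that \<open>(z, y)\<close> is the image of \<open>(x, y)\<close>, or \<open>z = u(x, y)\<close>.\<close>

section \<open>Differentiability in the plane from continuous partial derivatives\<close>

lemma C2_on_subset: "C2_on \<Omega> u \<Longrightarrow> R \<subseteq> \<Omega> \<Longrightarrow> C2_on R u"
  unfolding C2_on_def C1_on_def by (blast intro: continuous_on_subset)

lemma C1_on_partials:
  assumes "C1_on \<Omega> u" "(x, y) \<in> \<Omega>"
  shows "((\<lambda>s. u (s, y)) has_real_derivative partial_x u (x, y)) (at x)"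
    and "((\<lambda>t. u (x, t)) has_real_derivative partial_y u (x, y)) (at y)"
  using assms unfolding C1_on_def partial_x_def partial_y_def
  by (auto simp: real_differentiable_def DERIV_imp_deriv dest: DERIV_imp_deriv)

lemma C1_on_has_derivative:
  assumes "open \<Omega>" "C1_on \<Omega> u" "p \<in> \<Omega>"
  shows "(u has_derivative (\<lambda>(h, k). partial_x u p * h + partial_y u p * k)) (at p)"
proof -
  obtain x y where p: "p = (x, y)"
    by fastforce
  obtain A B where AB: "open A" "open B" "p \<in> A \<times> B" "A \<times> B \<subseteq> \<Omega>"
    using open_prod_elim[OF assms(1,3)] by metis
  then obtain e where e: "e > 0" "ball y e \<subseteq> B"
    using p open_contains_ball by blast
  let ?X = A and ?Y = "ball y e"
  have sub: "?X \<times> ?Y \<subseteq> \<Omega>"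
    using AB e by blast
  have xy: "x \<in> ?X" "y \<in> ?Y"
    using AB e p by auto
  have "((\<lambda>(s, t). u (s, t)) has_derivative
      (\<lambda>(h, k). partial_x u (x, y) * h + blinfun_mult_right (partial_y u (x, y)) k))
      (at (x, y) within ?X \<times> ?Y)"
  proof (rule has_derivative_partialsI[where fy = "\<lambda>s t. blinfun_mult_right (partial_y u (s, t))"])
    have "((\<lambda>s. u (s, y)) has_real_derivative partial_x u (x, y)) (at x)"
      using assms p by (intro C1_on_partials(1)) auto
    then show "((\<lambda>s. u (s, y)) has_derivative (*) (partial_x u (x, y))) (at x within ?X)"
      by (simp add: has_field_derivative_def has_derivative_at_withinI)
  next
    fix s t assume "s \<in> ?X" "t \<in> ?Y"
    then have "((\<lambda>t. u (s, t)) has_real_derivative partial_y u (s, t)) (at t)"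
      using sub by (intro C1_on_partials(2)[OF assms(2)]) auto
    then show "((\<lambda>t. u (s, t)) has_derivative blinfun_mult_right (partial_y u (s, t))) (at t within ?Y)"
      by (simp add: has_field_derivative_def has_derivative_at_withinI)
  next
    have "continuous (at (x, y) within ?X \<times> ?Y) (partial_y u)"
      using assms sub xy unfolding C1_on_def continuous_on_eq_continuous_within
      by (meson continuous_within_subset mem_Sigma_iff subsetD)
    then show "continuous (at (x, y) within ?X \<times> ?Y)
        (\<lambda>(s, t). blinfun_mult_right (partial_y u (s, t)))"
      by (simp add: case_prod_unfold
          bounded_linear.continuous[OF bounded_linear_blinfun_mult_right])
  qed (use xy in auto)
  moreover have "at (x, y) within ?X \<times> ?Y = at (x, y)"
    using AB xy by (intro at_within_open) (auto intro: open_Times)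
  ultimately show ?thesis
    by (simp add: p)
qed

lemma mixed_difference_mvt:
  fixes f fx fxy :: "real \<Rightarrow> real \<Rightarrow> real"
  assumes "h > 0"
    and fx: "\<And>s t. \<lbrakk>s \<in> {x..x+h}; t \<in> {y..y+h}\<rbrakk> \<Longrightarrow> ((\<lambda>s. f s t) has_real_derivative fx s t) (at s)"
    and fxy: "\<And>s t. \<lbrakk>s \<in> {x..x+h}; t \<in> {y..y+h}\<rbrakk> \<Longrightarrow> (fx s has_real_derivative fxy s t) (at t)"
  obtains s t where "s \<in> {x..x+h}" "t \<in> {y..y+h}"
    "f (x+h) (y+h) - f (x+h) y - f x (y+h) + f x y = h * h * fxy s t"
proof -
  have "\<exists>s. x < s \<and> s < x + h \<and> (\<lambda>s. f s (y+h) - f s y) (x+h) - (\<lambda>s. f s (y+h) - f s y) x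
      = (x + h - x) * (fx s (y+h) - fx s y)"
    using \<open>h > 0\<close> by (intro MVT2) (auto intro!: DERIV_diff fx)
  then obtain s where s: "x < s" "s < x + h"
    "f (x+h) (y+h) - f (x+h) y - (f x (y+h) - f x y) = h * (fx s (y+h) - fx s y)"
    by auto
  have "\<exists>t. y < t \<and> t < y + h \<and> fx s (y+h) - fx s y = (y + h - y) * fxy s t"
    using \<open>h > 0\<close> s by (intro MVT2) (auto intro!: fxy)
  then obtain t where "y < t" "t < y + h" "fx s (y+h) - fx s y = h * fxy s t"
    by auto
  with s show ?thesis
    by (intro that[of s t]) auto
qed

text \<open>The two mixed derivatives are, up to a point of evaluation, the same second difference quotient over
  a small square, taken in either order; the mean value theorem and continuity do the rest.\<close>
lemma mixed_partials_commute:
  assumes "open \<Omega>" "C2_on \<Omega> u" "p \<in> \<Omega>"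
  shows "partial_y (partial_x u) p = partial_x (partial_y u) p"
proof (rule ccontr)
  let ?f = "partial_y (partial_x u)" and ?g = "partial_x (partial_y u)"
  assume ne: "?f p \<noteq> ?g p"
  obtain x y where p: "p = (x, y)"
    by fastforce
  have C1: "C1_on \<Omega> u" "C1_on \<Omega> (partial_x u)" "C1_on \<Omega> (partial_y u)"
    using assms by (auto simp: C2_on_def)
  define e where "e = \<bar>?f p - ?g p\<bar> / 2"
  have "e > 0"
    using ne by (simp add: e_def)
  have "isCont ?f p" "isCont ?g p"
    using C1 assms unfolding C1_on_def by (auto simp: continuous_on_eq_continuous_at)
  then have "\<forall>\<^sub>F q in nhds p. dist (?f q) (?f p) < e \<and> dist (?g q) (?g p) < e \<and> q \<in> \<Omega>"
    using \<open>e > 0\<close> assms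
    by (intro eventually_conj)
      (auto simp: isCont_def tendsto_at_iff_tendsto_nhds eventually_nhds_in_open dest: tendstoD)
  then obtain d where d: "d > 0"
    "\<And>q. dist q p < d \<Longrightarrow> dist (?f q) (?f p) < e \<and> dist (?g q) (?g p) < e \<and> q \<in> \<Omega>"
    by (auto simp: eventually_nhds_metric)
  \<comment> \<open>Any \<open>h < d / 2\<close> keeps the square of side \<open>h\<close> at \<open>p\<close> inside the ball of radius \<open>d\<close>.\<close>
  define h where "h = d / 3"
  have "h > 0"
    using d by (simp add: h_def)
  have near: "dist (s, t) p < d" if "s \<in> {x..x+h}" "t \<in> {y..y+h}" for s t
  proof -
    have "dist (s, t) p \<le> dist s x + dist t y"
      by (simp add: p dist_Pair_Pair sqrt_sum_squares_le_sum)
    also have "\<dots> \<le> h + h"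
      using that by (intro add_mono) (auto simp: dist_real_def)
    also have "\<dots> < d"
      using d by (simp add: h_def)
    finally show ?thesis .
  qed
  obtain s t where st: "s \<in> {x..x+h}" "t \<in> {y..y+h}"
    "u (x+h, y+h) - u (x+h, y) - u (x, y+h) + u (x, y) = h * h * ?f (s, t)"
    using \<open>h > 0\<close> d(2) near C1
    by (rule_tac mixed_difference_mvt[where f = "\<lambda>s t. u (s, t)" and x = x and y = y and h = h
        and fx = "\<lambda>s t. partial_x u (s, t)" and fxy = "\<lambda>s t. ?f (s, t)"])
      (auto intro!: C1_on_partials)
  obtain t' s' where st': "t' \<in> {y..y+h}" "s' \<in> {x..x+h}"
    "u (x+h, y+h) - u (x, y+h) - u (x+h, y) + u (x, y) = h * h * ?g (s', t')"
    using \<open>h > 0\<close> d(2) near C1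
    by (rule_tac mixed_difference_mvt[where f = "\<lambda>t s. u (s, t)" and x = y and y = x and h = h
        and fx = "\<lambda>t s. partial_y u (s, t)" and fxy = "\<lambda>t s. ?g (s, t)"])
      (auto intro!: C1_on_partials)
  have "h * h * ?f (s, t) = h * h * ?g (s', t')"
    using st(3) st'(3) by linarith
  then have "?f (s, t) = ?g (s', t')"
    using \<open>h > 0\<close> by simp
  moreover have "dist (?f (s, t)) (?f p) < e" "dist (?g (s', t')) (?g p) < e"
    using d near st st' by blast+
  ultimately show False
    using e_def unfolding dist_real_def by argo
qed

section \<open>Functions of one variable\<close>

lemma C1_real_DERIV:
  assumes "C1_real f"
  shows "(f has_real_derivative deriv f x) (at x)"
proof -
  obtain d where d: "(f has_real_derivative d) (at x)"
    using assms by (auto simp: C1_real_def C1_differentiable_on_eq real_differentiable_def)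
  with DERIV_imp_deriv[OF d] show ?thesis
    by simp
qed

lemma C1_real_continuous_on: "C1_real f \<Longrightarrow> continuous_on S f"
  by (intro continuous_at_imp_continuous_on ballI DERIV_isCont[OF C1_real_DERIV])

lemma inj_on_if_deriv_nonzero:
  fixes f f' :: "real \<Rightarrow> real"
  assumes "\<And>x. x \<in> {a..b} \<Longrightarrow> (f has_real_derivative f' x) (at x)"
    and "\<And>x. x \<in> {a..b} \<Longrightarrow> f' x \<noteq> 0"
  shows "inj_on f {a..b}"
proof -
  have ne: "f x \<noteq> f y" if "x \<in> {a..b}" "y \<in> {a..b}" "x < y" for x y
  proof
    assume "f x = f y"
    moreover have "\<exists>z. x < z \<and> z < y \<and> f y - f x = (y - x) * f' z"
      using that by (intro MVT2) (auto intro!: assms(1))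
    ultimately show False
      using that assms(2) by auto
  qed
  show ?thesis
    by (rule inj_onI) (metis ne linorder_neqE_linordered_idom)
qed

text \<open>A continuous injective function is monotone, so on a segment it departs farthest from its value at
  one end when it reaches the other end. This keeps a characteristic inside the strip that contains its
  end points.\<close>
lemma abs_diff_mono_on_segment:
  fixes f :: "real \<Rightarrow> real"
  assumes "continuous_on (closed_segment r s) f" "inj_on f (closed_segment r s)"
    and "q \<in> closed_segment r s"
  shows "\<bar>f q - f r\<bar> \<le> \<bar>f s - f r\<bar>"
proof (cases "q = r \<or> q = s")
  case False
  show ?thesis
  proof (cases "r \<le> s")
    case True
    with False assms continuous_inj_imp_mono[of r q s f] show ?thesis
      by (auto simp: closed_segment_eq_real_ivl)
  next
    case rs: False
    with False assms continuous_inj_imp_mono[of s q r f] show ?thesis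
      by (auto simp: closed_segment_eq_real_ivl)
  qed
qed auto

section \<open>The hodograph transformation\<close>

text \<open>A region in which \<open>u\<close> can replace \<open>x\<close> as a coordinate. Convexity makes the horizontal slices intervals,
  so that \<open>u\<^sub>x \<noteq> 0\<close> gives injectivity of the hodograph map on the whole region, and not just locally.\<close>
locale hodograph_patch =
  fixes R :: "(real \<times> real) set" and u :: "real \<times> real \<Rightarrow> real"
  assumes open_R: "open R" and convex_R: "convex R" and C2: "C2_on R u"
    and pde: "\<And>p. p \<in> R \<Longrightarrow> pde_at u p"
    and ux_nonzero: "\<And>p. p \<in> R \<Longrightarrow> partial_x u p \<noteq> 0"
begin

definition hodo :: "real \<times> real \<Rightarrow> real \<times> real" where
  "hodo p = (u p, snd p)"

definition hodo_inv :: "real \<times> real \<Rightarrow> real \<times> real" where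
  "hodo_inv = the_inv_into R hodo"

text \<open>The slope \<open>dx / dy\<close> of the characteristics \<open>u - y = const\<close>; it is also the derivative
  \<open>\<xi>\<^sub>v + \<xi>\<^sub>y\<close> of the inverse function \<open>\<xi>\<close> along them.\<close>
definition slope :: "real \<times> real \<Rightarrow> real" where
  "slope p = (1 - partial_y u p) / partial_x u p"

lemma C1:
  shows C1_u: "C1_on R u" and C1_ux: "C1_on R (partial_x u)" and C1_uy: "C1_on R (partial_y u)"
  using C2 by (auto simp: C2_on_def)

lemma inj_hodo: "inj_on hodo R"
proof -
  have no_coincidence: "u (x, y) \<noteq> u (x', y)" if "(x, y) \<in> R" "(x', y) \<in> R" "x < x'" for x x' y
  proof
    assume eq: "u (x, y) = u (x', y)"
    have in_R: "(s, y) \<in> R" if "s \<in> {x..x'}" for s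
    proof -
      have "(s, y) \<in> closed_segment (x, y) (x', y)"
        using that \<open>x < x'\<close> closed_segment_same_snd[of "(x, y)" "(x', y)"]
        by (auto simp: closed_segment_PairD closed_segment_eq_real_ivl)
      then show ?thesis
        using that convex_R \<open>(x, y) \<in> R\<close> \<open>(x', y) \<in> R\<close>
        by (meson convex_contains_segment subsetD)
    qed
    have "\<exists>s. x < s \<and> s < x' \<and> u (x', y) - u (x, y) = (x' - x) * partial_x u (s, y)"
      using that in_R by (intro MVT2) (auto intro!: C1_on_partials[OF C1_u])
    with eq that in_R ux_nonzero show False
      by fastforce
  qed
  show ?thesis
  proof (rule inj_onI)
    fix p q assume pq: "p \<in> R" "q \<in> R" "hodo p = hodo q"
    obtain x x' y where "p = (x, y)" "q = (x', y)"
      using pq(3) by (cases p, cases q) (auto simp: hodo_def)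
    with pq no_coincidence[of x y x'] no_coincidence[of x' y x] show "p = q"
      by (cases x x' rule: linorder_cases) (auto simp: hodo_def)
  qed
qed

lemma hodo_inv_hodo [simp]: "p \<in> R \<Longrightarrow> hodo_inv (hodo p) = p"
  by (simp add: hodo_inv_def the_inv_into_f_f inj_hodo)

lemma
  assumes "w \<in> hodo ` R"
  shows hodo_inv_in_R: "hodo_inv w \<in> R" and hodo_hodo_inv: "hodo (hodo_inv w) = w"
  using assms by auto

lemma u_has_derivative:
  "p \<in> R \<Longrightarrow> (u has_derivative (\<lambda>(h, k). partial_x u p * h + partial_y u p * k)) (at p)"
  using C1_on_has_derivative[OF open_R C1_u] .

lemma hodo_has_derivative:
  assumes "p \<in> R"
  shows "(hodo has_derivative (\<lambda>(h, k). (partial_x u p * h + partial_y u p * k, k))) (at p)"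
  unfolding hodo_def[abs_def]
  by (auto intro!: derivative_eq_intros u_has_derivative[OF assms] simp: case_prod_unfold)

lemma continuous_on_hodo: "continuous_on R hodo"
  using has_derivative_at_withinI[OF hodo_has_derivative] by (rule has_derivative_continuous_on)

lemma open_hodo_image: "open (hodo ` R)"
  using invariance_of_domain[OF continuous_on_hodo open_R inj_hodo] .

text \<open>These are the formulas \<open>\<xi>\<^sub>v = 1 / u\<^sub>x\<close> and \<open>\<xi>\<^sub>y = - u\<^sub>y / u\<^sub>x\<close>, for \<open>\<xi>\<close> the first component of the
  inverse.\<close>
lemma hodo_inv_has_derivative:
  assumes "w \<in> hodo ` R"
  shows "(hodo_inv has_derivative (\<lambda>(h, k). ((h - partial_y u (hodo_inv w) * k) / partial_x u (hodo_inv w), k))) (at w)"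
proof -
  have "(hodo_inv has_derivative (\<lambda>(h, k). ((h - partial_y u (hodo_inv w) * k) / partial_x u (hodo_inv w), k)))
      (at (hodo (hodo_inv w)))"
    using ux_nonzero[OF hodo_inv_in_R[OF assms]]
    by (intro has_derivative_inverse_strong[OF open_R hodo_inv_in_R[OF assms] continuous_on_hodo hodo_inv_hodo
          hodo_has_derivative[OF hodo_inv_in_R[OF assms]]])
      (auto simp: fun_eq_iff)
  then show ?thesis
    by (simp add: hodo_hodo_inv[OF assms])
qed

lemma slope_has_derivative:
  assumes "p \<in> R"
  shows "(slope has_derivative (\<lambda>(h, k).
      - ((partial_x (partial_y u) p * h + partial_y (partial_y u) p * k) * partial_x u p
        + (1 - partial_y u p) * (partial_x (partial_x u) p * h + partial_y (partial_x u) p * k))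
      / (partial_x u p)\<^sup>2)) (at p)"
  unfolding slope_def[abs_def]
  using ux_nonzero[OF assms]
  by (auto intro!: derivative_eq_intros C1_on_has_derivative[OF open_R C1_ux assms]
      C1_on_has_derivative[OF open_R C1_uy assms]
      simp: case_prod_unfold power2_eq_square algebra_simps)

lemma hodo_inv_curve:
  assumes "(\<gamma> has_vector_derivative (h, k)) (at t within S)" "\<gamma> t \<in> hodo ` R"
  shows "((\<lambda>t. hodo_inv (\<gamma> t)) has_vector_derivative
    ((h - partial_y u (hodo_inv (\<gamma> t)) * k) / partial_x u (hodo_inv (\<gamma> t)), k)) (at t within S)"
  using vector_derivative_diff_chain_within[OF assms(1)
      has_derivative_at_withinI[OF hodo_inv_has_derivative[OF assms(2)]]]
  by (simp add: o_def)

text \<open>One factor of the wave equation, \<open>(\<partial>\<^sub>y - \<partial>\<^sub>v) (\<xi>\<^sub>v + \<xi>\<^sub>y) = 0\<close>: the slope of one family of characteristics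
  does not change along the other family.\<close>
lemma slope_stationary:
  assumes "(c - t, t) \<in> hodo ` R"
  shows "((\<lambda>t. slope (hodo_inv (c - t, t))) has_vector_derivative 0) (at t within S)"
proof -
  let ?p = "hodo_inv (c - t, t)"
  let ?h = "(- 1 - partial_y u ?p) / partial_x u ?p"
  note p = hodo_inv_in_R[OF assms]
  have "((\<lambda>t. (c - t, t)) has_vector_derivative (- 1, 1)) (at t within S)"
    by (auto intro!: derivative_eq_intros)
  from hodo_inv_curve[OF this assms]
  have hodo_inv': "((\<lambda>t. hodo_inv (c - t, t)) has_vector_derivative (?h, 1)) (at t within S)"
    by simp
  \<comment> \<open>Along \<open>(c - t, t)\<close> the first coordinate of \<^term>\<open>hodo_inv\<close> has derivative \<open>(- 1 - u\<^sub>y) / u\<^sub>x\<close>; with this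
    direction inserted, the numerator of the derivative of the slope is, up to sign, the left-hand side
    of the equation divided by \<open>u\<^sub>x\<close>.\<close>
  have eliminate: "(B * ((- 1 - q) / d) + C) * d + (1 - q) * (A * ((- 1 - q) / d) + B) = 0"
    if "(q\<^sup>2 - 1) * A - 2 * d * q * B + d\<^sup>2 * C = 0" "d \<noteq> 0" for A B C d q :: real
  proof -
    have "((B * ((- 1 - q) / d) + C) * d + (1 - q) * (A * ((- 1 - q) / d) + B)) * d
        = (q\<^sup>2 - 1) * A - 2 * d * q * B + d\<^sup>2 * C"
      using that(2) by (simp add: field_simps power2_eq_square)
    with that show ?thesis
      by simp
  qed
  have "(partial_x (partial_y u) ?p * ?h + partial_y (partial_y u) ?p) * partial_x u ?p
        + (1 - partial_y u ?p) * (partial_x (partial_x u) ?p * ?h + partial_y (partial_x u) ?p) = 0"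
    using pde[OF p] ux_nonzero[OF p] unfolding pde_at_def mixed_partials_commute[OF open_R C2 p]
    by (rule eliminate)
  with vector_derivative_diff_chain_within[OF hodo_inv'
      has_derivative_at_withinI[OF slope_has_derivative[OF p]]]
  show ?thesis
    by (simp add: o_def del: minus_add_distrib)
qed

lemma slope_constant:
  assumes "\<And>t. t \<in> closed_segment 0 y \<Longrightarrow> (c - t, t) \<in> hodo ` R"
  shows "slope (hodo_inv (c - y, y)) = slope (hodo_inv (c, 0))"
proof -
  obtain k where "\<And>t. t \<in> closed_segment 0 y \<Longrightarrow> slope (hodo_inv (c - t, t)) = k"
    using has_vector_derivative_zero_constant[OF convex_closed_segment slope_stationary[OF assms]]
    by metis
  from this[of 0] this[of y] show ?thesis
    by simp
qed

section \<open>d'Alembert's formula in characteristic coordinates\<close>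

text \<open>The point with \<open>u + y = \<tau> s\<close> and \<open>u - y = \<tau> r\<close> is reached from \<open>(r, 0)\<close> along the
  characteristic \<open>u - y = \<tau> r\<close>. At the point where \<open>u + y = \<tau> q\<close>, the slope still has its initial value
  \<open>(1 - \<nu> q) / \<tau>' q\<close>, while \<open>y = (\<tau> q - \<tau> r) / 2\<close> changes at the rate \<open>\<tau>' q / 2\<close>; hence
  \<open>dx / dq = (1 - \<nu> q) / 2\<close>. Taking \<open>q\<close> and not \<open>y\<close> as the parameter avoids differentiating the inverse of
  \<open>\<tau>\<close>, at the ends of the interval in particular. The strip hypothesis keeps both families of
  characteristics inside the image of the hodograph map.\<close>
lemma dAlembert:
  assumes seg: "{a..b} \<times> {0} \<subseteq> R"
    and data: "\<And>x. x \<in> {a..b} \<Longrightarrow> u (x, 0) = \<tau> x"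
      "\<And>x. x \<in> {a..b} \<Longrightarrow> partial_y u (x, 0) = \<nu> x"
    and data_x: "\<And>x. x \<in> {a..b} \<Longrightarrow> (\<tau> has_real_derivative partial_x u (x, 0)) (at x)"
    and cont: "continuous_on {a..b} \<nu>"
    and sr: "r \<in> {a..b}" "s \<in> {a..b}"
    and between: "\<And>q. q \<in> closed_segment r s \<Longrightarrow> \<bar>\<tau> q - \<tau> r\<bar> \<le> 2 * \<epsilon>"
    and strip: "\<And>x t. x \<in> {a..b} \<Longrightarrow> \<bar>t\<bar> \<le> \<epsilon> \<Longrightarrow> (\<tau> x + t, t) \<in> hodo ` R \<and> (\<tau> x - t, t) \<in> hodo ` R"
  shows "fst (hodo_inv ((\<tau> s + \<tau> r) / 2, (\<tau> s - \<tau> r) / 2)) =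
    a + 1/2 * integral {a..s} (\<lambda>t. 1 - \<nu> t) + 1/2 * integral {a..r} (\<lambda>t. 1 + \<nu> t)"
proof -
  \<comment> \<open>The image in the \<open>(u, y)\<close>-plane of the characteristic \<open>u - y = \<tau> r\<close>: it starts on the data
    at \<open>(\<tau> r, 0)\<close>, and \<open>u + y = \<tau> q\<close> at parameter \<open>q\<close>.\<close>
  define \<gamma> where "\<gamma> q = ((\<tau> q + \<tau> r) / 2, (\<tau> q - \<tau> r) / 2)" for q
  define F where "F q = fst (hodo_inv (\<gamma> q)) - 1/2 * integral {a..q} (\<lambda>t. 1 - \<nu> t)" for q
  have sub: "closed_segment r s \<subseteq> {a..b}"
    using sr by (auto simp: closed_segment_eq_real_ivl)
  have start: "hodo_inv (\<tau> x, 0) = (x, 0)" if "x \<in> {a..b}" for x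
    using hodo_inv_hodo[of "(x, 0)"] subsetD[OF seg, of "(x, 0)"] that data by (simp add: hodo_def)
  have F': "(F has_vector_derivative 0) (at q within closed_segment r s)" if q: "q \<in> closed_segment r s" for q
  proof -
    have qab: "q \<in> {a..b}"
      using q sub by blast
    define y where "y = (\<tau> q - \<tau> r) / 2"
    have y: "\<bar>y\<bar> \<le> \<epsilon>"
      using between[OF q] by (simp add: y_def)
    have \<gamma>_q: "\<gamma> q = (\<tau> r + y, y)" "\<gamma> q = (\<tau> q - y, y)"
      by (auto simp: \<gamma>_def y_def field_simps)
    have in_image: "\<gamma> q \<in> hodo ` R"
      unfolding \<gamma>_q(1) using strip[OF sr(1) y] by blast
    \<comment> \<open>Go back to the initial line along the other characteristic through \<open>\<gamma> q\<close>.\<close>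
    have "slope (hodo_inv (\<gamma> q)) = slope (hodo_inv (\<tau> q, 0))"
      unfolding \<gamma>_q(2)
    proof (rule slope_constant)
      fix t assume "t \<in> closed_segment 0 y"
      then have "\<bar>t\<bar> \<le> \<epsilon>"
        using y by (auto simp: closed_segment_eq_real_ivl split: if_splits)
      then show "(\<tau> q - t, t) \<in> hodo ` R"
        using strip[OF qab] by blast
    qed
    then have slope: "slope (hodo_inv (\<gamma> q)) = (1 - \<nu> q) / partial_x u (q, 0)"
      using start[OF qab] data(2)[OF qab] by (simp add: slope_def)
    define d where "d = partial_x u (q, 0)"
    have "d \<noteq> 0"
      using ux_nonzero[OF subsetD[OF seg, of "(q, 0)"]] qab by (simp add: d_def)
    have \<tau>': "(\<tau> has_real_derivative d) (at q within closed_segment r s)"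
      using data_x[OF qab] by (simp add: d_def has_field_derivative_at_within)
    have "((\<lambda>q. (\<tau> q + \<tau> r) / 2) has_real_derivative d / 2) (at q within closed_segment r s)"
      "((\<lambda>q. (\<tau> q - \<tau> r) / 2) has_real_derivative d / 2) (at q within closed_segment r s)"
      by (auto intro!: derivative_eq_intros \<tau>')
    then have "(\<gamma> has_vector_derivative (d / 2, d / 2)) (at q within closed_segment r s)"
      unfolding \<gamma>_def[abs_def] has_real_derivative_iff_has_vector_derivative
      by (rule has_vector_derivative_Pair)
    from hodo_inv_curve[OF this in_image]
    have "((\<lambda>q. fst (hodo_inv (\<gamma> q))) has_vector_derivative
        (d / 2 - partial_y u (hodo_inv (\<gamma> q)) * (d / 2)) / partial_x u (hodo_inv (\<gamma> q))) (at q within closed_segment r s)"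
      by (auto simp: has_vector_derivative_def dest!: has_derivative_fst)
    moreover have "(d / 2 - partial_y u (hodo_inv (\<gamma> q)) * (d / 2)) / partial_x u (hodo_inv (\<gamma> q))
        = d / 2 * slope (hodo_inv (\<gamma> q))"
      by (simp add: slope_def field_simps)
    moreover have "d / 2 * slope (hodo_inv (\<gamma> q)) = (1 - \<nu> q) / 2"
      using slope \<open>d \<noteq> 0\<close> by (simp add: d_def)
    ultimately have "((\<lambda>q. fst (hodo_inv (\<gamma> q))) has_real_derivative (1 - \<nu> q) / 2) (at q within closed_segment r s)"
      by (simp only: has_real_derivative_iff_has_vector_derivative)
    moreover have "((\<lambda>q. integral {a..q} (\<lambda>t. 1 - \<nu> t)) has_real_derivative 1 - \<nu> q)
        (at q within closed_segment r s)"
      by (intro DERIV_subset[OF integral_has_real_derivative[OF _ qab] sub] continuous_intros cont)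
    ultimately have "(F has_real_derivative (1 - \<nu> q) / 2 - 1/2 * (1 - \<nu> q)) (at q within closed_segment r s)"
      unfolding F_def[abs_def] by (intro DERIV_diff DERIV_cmult)
    then show ?thesis
      by (simp add: has_real_derivative_iff_has_vector_derivative)
  qed
  obtain k where "\<And>q. q \<in> closed_segment r s \<Longrightarrow> F q = k"
    using has_vector_derivative_zero_constant[OF convex_closed_segment F'] by metis
  then have "F s = F r"
    by simp
  moreover have "F r = r - 1/2 * integral {a..r} (\<lambda>t. 1 - \<nu> t)"
    using start[OF sr(1)] by (simp add: F_def \<gamma>_def)
  moreover have "integral {a..r} (\<lambda>t. 1 - \<nu> t) + integral {a..r} (\<lambda>t. 1 + \<nu> t) = 2 * (r - a)"
  proof -
    have "\<nu> integrable_on {a..r}"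
      using cont sr by (intro integrable_continuous_interval) (auto elim: continuous_on_subset)
    then have "integral {a..r} (\<lambda>t. 1 - \<nu> t) = integral {a..r} (\<lambda>_. 1) - integral {a..r} \<nu>"
      "integral {a..r} (\<lambda>t. 1 + \<nu> t) = integral {a..r} (\<lambda>_. 1) + integral {a..r} \<nu>"
      by (simp_all only: integral_diff integral_add integrable_const_ivl)
    then show ?thesis
      using sr by simp
  qed
  ultimately have "fst (hodo_inv (\<gamma> s)) =
      a + 1/2 * integral {a..s} (\<lambda>t. 1 - \<nu> t) + 1/2 * integral {a..r} (\<lambda>t. 1 + \<nu> t)"
    using F_def[of s] by argo
  then show ?thesis
    by (simp only: \<gamma>_def)
qed

end

section \<open>The Cauchy problem near its data segment\<close>

lemma convex_ball_neighbourhood: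
  fixes K :: "'a::real_normed_vector set"
  assumes "convex K"
  shows "convex (\<Union>x\<in>K. ball x e)"
proof -
  have "(\<Union>x\<in>K. ball x e) = (\<Union>x\<in>K. \<Union>y\<in>ball 0 e. {x + y})"
    by (simp add: UNION_singleton_eq_range)
  then show ?thesis
    by (simp only: convex_sums[OF assms convex_ball])
qed

text \<open>The data prescribe \<open>u\<close> on the segment only, so at its end points \<open>u\<^sub>x\<close> is identified with \<open>\<tau>'\<close> through
  one-sided derivatives.\<close>
lemma partial_x_initial:
  assumes "a < b" "C1_on \<Omega> u" "{a..b} \<times> {0} \<subseteq> \<Omega>"
    and "\<And>x. x \<in> {a..b} \<Longrightarrow> u (x, 0) = \<tau> x" "(\<tau> has_real_derivative d) (at x)" "x \<in> {a..b}"
  shows "partial_x u (x, 0) = d"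
proof (rule vector_derivative_unique_within_closed_interval)
  show "((\<lambda>s. u (s, 0)) has_vector_derivative partial_x u (x, 0)) (at x within cbox a b)"
    using C1_on_partials(1)[OF assms(2), of x 0] subsetD[OF assms(3), of "(x, 0)"] assms(6)
    by (simp add: has_real_derivative_iff_has_vector_derivative has_vector_derivative_at_within)
  have "(\<tau> has_vector_derivative d) (at x within cbox a b)"
    using assms(5) by (simp add: has_real_derivative_iff_has_vector_derivative has_vector_derivative_at_within)
  then show "((\<lambda>s. u (s, 0)) has_vector_derivative d) (at x within cbox a b)"
    by (rule has_vector_derivative_transform[rotated 2]) (use assms in auto)
qed (use assms in auto)

lemma noncharacteristic_patch:
  assumes "a < b" and sol: "cauchy_solution a b \<tau> \<nu> \<Omega> u"
    and \<tau>': "\<And>x. x \<in> {a..b} \<Longrightarrow> (\<tau> has_real_derivative \<tau>' x) (at x)"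
      "\<And>x. x \<in> {a..b} \<Longrightarrow> \<tau>' x \<noteq> 0"
  obtains R where "hodograph_patch R u" "{a..b} \<times> {0} \<subseteq> R" "R \<subseteq> \<Omega>"
proof -
  let ?K = "{a..b} \<times> {0::real}"
  have \<Omega>: "open \<Omega>" "?K \<subseteq> \<Omega>" "C2_on \<Omega> u" "C1_on \<Omega> u"
    using sol by (auto simp: cauchy_solution_def C2_on_def)
  \<comment> \<open>On the initial segment \<open>u\<^sub>x = \<tau>'\<close> does not vanish, so neither does it nearby.\<close>
  define \<Omega>' where "\<Omega>' = \<Omega> \<inter> partial_x u -` (- {0})"
  have "open \<Omega>'"
    using \<Omega> unfolding \<Omega>'_def C1_on_def by (intro continuous_open_preimage) auto
  moreover have "?K \<subseteq> \<Omega>'"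
    using \<Omega> sol \<tau>' partial_x_initial[OF \<open>a < b\<close> \<Omega>(4,2) _ \<tau>'(1)]
    by (auto simp: \<Omega>'_def cauchy_solution_def)
  moreover have "compact ?K"
    by (intro compact_Times) auto
  ultimately obtain e where e: "e > 0" "(\<Union>p\<in>?K. ball p e) \<subseteq> \<Omega>'"
    using compact_subset_open_imp_ball_epsilon_subset by metis
  let ?R = "\<Union>p\<in>?K. ball p e"
  have sub: "p \<in> \<Omega>" "partial_x u p \<noteq> 0" if "p \<in> ?R" for p
    using subsetD[OF e(2) that] by (auto simp: \<Omega>'_def)
  have "hodograph_patch ?R u"
  proof
    show "open ?R"
      by (intro open_UN) auto
    show "convex ?R"
      by (intro convex_ball_neighbourhood convex_Times) auto
    show "C2_on ?R u"
      using C2_on_subset[OF \<Omega>(3)] sub(1) by blast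
    show "pde_at u p" if "p \<in> ?R" for p
      using sol sub(1)[OF that] by (simp add: cauchy_solution_def)
    show "partial_x u p \<noteq> 0" if "p \<in> ?R" for p
      using sub(2)[OF that] .
  qed
  moreover have "?K \<subseteq> ?R"
    using e(1) by force
  ultimately show ?thesis
    using that[of ?R] sub(1) by blast
qed

text \<open>A strip of uniform width exists by compactness. It is swept out by the lines of the two
  characteristic directions through the points of \<open>C \<times> {0}\<close>.\<close>
lemma (in hodograph_patch) uniform_strip:
  fixes C :: "real set"
  assumes "compact C" "C \<times> {0} \<subseteq> hodo ` R"
  obtains \<epsilon> where "\<epsilon> > 0" "\<And>c t. c \<in> C \<Longrightarrow> \<bar>t\<bar> \<le> \<epsilon> \<Longrightarrow> (c + t, t) \<in> hodo ` R \<and> (c - t, t) \<in> hodo ` R"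
proof -
  obtain \<eta> where \<eta>: "\<eta> > 0" "(\<Union>p\<in>C \<times> {0}. ball p \<eta>) \<subseteq> hodo ` R"
    using compact_subset_open_imp_ball_epsilon_subset[OF compact_Times[OF assms(1) compact_sing] open_hodo_image assms(2)]
    by metis
  have shifted: "(c + k, t) \<in> hodo ` R" if "c \<in> C" "\<bar>t\<bar> \<le> \<eta> / 3" "\<bar>k\<bar> = \<bar>t\<bar>" for c t k
  proof -
    have "dist (c, 0) (c + k, t) \<le> \<bar>k\<bar> + \<bar>t\<bar>"
      using sqrt_sum_squares_le_sum_abs[of k t] by (simp add: dist_Pair_Pair dist_real_def)
    also have "\<dots> < \<eta>"
      using that \<eta>(1) by linarith
    finally show ?thesis
      using that \<eta>(2) by (meson SigmaI UN_I mem_ball singletonI subsetD)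
  qed
  show ?thesis
  proof (rule that[of "\<eta> / 3"])
    show "(c + t, t) \<in> hodo ` R \<and> (c - t, t) \<in> hodo ` R" if "c \<in> C" "\<bar>t\<bar> \<le> \<eta> / 3" for c t
      using shifted[OF that, of t] shifted[OF that, of "- t"] by simp
  qed (use \<eta>(1) in simp)
qed

theorem theorem1:
  fixes a b :: real and \<tau> \<nu> :: "real \<Rightarrow> real"
    and \<Omega> :: "(real \<times> real) set" and u :: "real \<times> real \<Rightarrow> real"
  defines "T \<equiv> the_inv_into {a..b} \<tau>"
  assumes "a < b"
    and "C2_real \<tau>" and "C1_real \<nu>"
    and "\<forall>x\<in>{a..b}. deriv \<tau> x \<noteq> 0"
    and "cauchy_solution a b \<tau> \<nu> \<Omega> u"
  shows "inj_on \<tau> {a..b} \<and>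
    (\<exists>V. open V \<and> {a..b} \<times> {0} \<subseteq> V \<and> V \<subseteq> \<Omega> \<and>
      (\<forall>x y. (x, y) \<in> V \<longrightarrow>
        (u (x, y) + y \<in> \<tau> ` {a..b} \<and> u (x, y) - y \<in> \<tau> ` {a..b} \<longrightarrow>
           integral_relation a \<nu> T x y (u (x, y))) \<and>
        (\<forall>z. z + y \<in> \<tau> ` {a..b} \<and> z - y \<in> \<tau> ` {a..b} \<and> integral_relation a \<nu> T x y z \<longrightarrow>
           z = u (x, y))))"
proof -
  have \<tau>': "(\<tau> has_real_derivative deriv \<tau> x) (at x)" for x
    using assms(3) C1_real_DERIV by (auto simp: C2_real_def)
  have cont_\<tau>: "continuous_on S \<tau>" for S
    using assms(3) C1_real_continuous_on by (auto simp: C2_real_def)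
  have inj: "inj_on \<tau> {a..b}"
    using assms(5) by (intro inj_on_if_deriv_nonzero[OF \<tau>']) auto
  obtain R where patch: "hodograph_patch R u" and R: "{a..b} \<times> {0} \<subseteq> R" "R \<subseteq> \<Omega>"
    by (rule noncharacteristic_patch[OF assms(2,6), of "deriv \<tau>"]) (use \<tau>' assms(5) in auto)
  interpret hodograph_patch R u
    by (rule patch)
  have data: "u (x, 0) = \<tau> x" "partial_y u (x, 0) = \<nu> x" if "x \<in> {a..b}" for x
    using assms(6) that by (auto simp: cauchy_solution_def)
  have data_x: "partial_x u (x, 0) = deriv \<tau> x" if "x \<in> {a..b}" for x
    using partial_x_initial[OF assms(2) C1_u R(1) data(1) \<tau>' that] .
  have data_x': "(\<tau> has_real_derivative partial_x u (x, 0)) (at x)" if "x \<in> {a..b}" for x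
    using data_x[OF that] \<tau>' by simp
  have "\<tau> ` {a..b} \<times> {0} \<subseteq> hodo ` R"
  proof
    fix w :: "real \<times> real" assume "w \<in> \<tau> ` {a..b} \<times> {0}"
    then obtain x where "x \<in> {a..b}" "w = hodo (x, 0)"
      using data by (auto simp: hodo_def)
    with R show "w \<in> hodo ` R"
      by blast
  qed
  then obtain \<epsilon> where "\<epsilon> > 0" and
    strip: "\<And>c t. c \<in> \<tau> ` {a..b} \<Longrightarrow> \<bar>t\<bar> \<le> \<epsilon> \<Longrightarrow> (c + t, t) \<in> hodo ` R \<and> (c - t, t) \<in> hodo ` R"
    using uniform_strip[OF compact_continuous_image[OF cont_\<tau> compact_Icc]] by metis
  \<comment> \<open>The relation singles out the one \<open>x\<close> for which \<open>(x, y)\<close> in the patch has hodograph image \<open>(z, y)\<close>;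
    injectivity of the hodograph map then yields both halves of the theorem.\<close>
  have relation_iff: "integral_relation a \<nu> T x y z \<longleftrightarrow> x = fst (hodo_inv (z, y))"
    if z: "z + y \<in> \<tau> ` {a..b}" "z - y \<in> \<tau> ` {a..b}" and y: "\<bar>y\<bar> \<le> \<epsilon>" for x y z
  proof -
    obtain s r where s: "s \<in> {a..b}" "z + y = \<tau> s" and r: "r \<in> {a..b}" "z - y = \<tau> r"
      using z by auto
    \<comment> \<open>The Riemann invariants \<open>z + y\<close> and \<open>z - y\<close> serve as characteristic coordinates.\<close>
    have zy: "z = (\<tau> s + \<tau> r) / 2" "y = (\<tau> s - \<tau> r) / 2"
      using s r by auto
    have "closed_segment r s \<subseteq> {a..b}"
      using s r by (auto simp: closed_segment_eq_real_ivl)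
    then have between: "\<bar>\<tau> q - \<tau> r\<bar> \<le> 2 * \<epsilon>" if "q \<in> closed_segment r s" for q
      using abs_diff_mono_on_segment[OF cont_\<tau> inj_on_subset[OF inj] that] y zy by simp
    have "fst (hodo_inv (z, y)) =
        a + 1/2 * integral {a..s} (\<lambda>t. 1 - \<nu> t) + 1/2 * integral {a..r} (\<lambda>t. 1 + \<nu> t)"
      unfolding zy
      by (rule dAlembert[OF R(1) data data_x' C1_real_continuous_on[OF assms(4)] r(1) s(1) between strip[OF imageI]])
    moreover have "T (z + y) = s" "T (z - y) = r"
      using s r by (simp_all add: T_def the_inv_into_f_f[OF inj])
    ultimately show ?thesis
      by (simp add: integral_relation_def)
  qed
  define V where "V = R \<inter> {p. \<bar>snd p\<bar> < \<epsilon>}"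
  have "open {p :: real \<times> real. \<bar>snd p\<bar> < \<epsilon>}"
    by (intro open_Collect_less continuous_intros)
  then have open_V: "open V"
    unfolding V_def using open_R by blast
  have V: "{a..b} \<times> {0} \<subseteq> V" "V \<subseteq> \<Omega>"
    using R \<open>\<epsilon> > 0\<close> by (auto simp: V_def)
  have relation: "integral_relation a \<nu> T x y (u (x, y))"
    if "(x, y) \<in> V" "u (x, y) + y \<in> \<tau> ` {a..b}" "u (x, y) - y \<in> \<tau> ` {a..b}" for x y
    using that relation_iff[OF that(2,3)] hodo_inv_hodo[of "(x, y)"] by (simp add: V_def hodo_def)
  have unique: "z = u (x, y)"
    if "(x, y) \<in> V" and z: "z + y \<in> \<tau> ` {a..b}" "z - y \<in> \<tau> ` {a..b}"
      and rel: "integral_relation a \<nu> T x y z" for x y z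
  proof -
    have y: "\<bar>y\<bar> \<le> \<epsilon>"
      using that(1) by (simp add: V_def)
    have "(z, y) \<in> hodo ` R"
      using strip[OF z(1) y] by simp
    from hodo_hodo_inv[OF this] have "u (hodo_inv (z, y)) = z" "snd (hodo_inv (z, y)) = y"
      by (simp_all add: hodo_def)
    moreover have "fst (hodo_inv (z, y)) = x"
      using rel relation_iff[OF z y] by simp
    ultimately have "hodo_inv (z, y) = (x, y)"
      by (simp add: prod_eq_iff)
    with \<open>u (hodo_inv (z, y)) = z\<close> show ?thesis
      by simp
  qed
  show ?thesis
  proof (intro conjI exI[of _ V] allI impI)
    fix x y assume xy: "(x, y) \<in> V"
    show "integral_relation a \<nu> T x y (u (x, y))"
      if "u (x, y) + y \<in> \<tau> ` {a..b} \<and> u (x, y) - y \<in> \<tau> ` {a..b}"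
      by (intro relation xy conjunct1[OF that] conjunct2[OF that])
    show "z = u (x, y)"
      if "z + y \<in> \<tau> ` {a..b} \<and> z - y \<in> \<tau> ` {a..b} \<and> integral_relation a \<nu> T x y z" for z
      using that by (elim conjE) (rule unique[OF xy])
  qed (fact inj open_V V)+
qed

end
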